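(* Let $\mathcal{E}\colon\mathbb{R}\to\mathbb{R}$ be the unweighted error-sum function of continued fractions, $\mathcal{E}(x)=\sum_{n\ge 0}\bigl(x-\tfrac{p_n(x)}{q_n(x)}\bigr)$. Then the graph $\{(x,\mathcal{E}(x)) : x\in\mathbb{R}\}\subseteq\mathbb{R}^2$ has Hausdorff dimension exactly $1$.
   Context: Continued fraction (CF) expansion: for $y\in[0,1)$ put $d_1(y)=\lfloor 1/y\rfloor$ and $T(y)=1/y-d_1(y)$ if $y\neq 0$, and $d_1(0)=\infty$, $T(0)=0$; set $d_n(y)=d_1(T^{n-1}(y))$ for $n\ge1$. For $x\in\mathbb{R}$ let $d_0(x)=\lfloor x\rfloor$ and $d_n(x)=d_n(x-\lfloor x\rfloor)$ for $n\ge1$. The $n$th convergent is $\frac{p_n(x)}{q_n(x)}=[d_0(x);d_1(x),\dots,d_n(x),\infty,\infty,\dots]$, where $[\sigma_0;\sigma_1,\sigma_2,\dots]=\sigma_0+\cfrac{1}{\sigma_1+\cfrac{1}{\sigma_2+\ddots}}$ with the conventions $1/\infty=0$, $\infty+c=\infty$, $\infty+\infty=\infty$; here $p_0(x)=d_0(x)$, $q_0(x)=1$, and for $n\ge1$, $p_n(x)/q_n(x)$ is written in lowest terms with $q_n(x)\ge1$. (If the expansion of $x$ terminates, the convergents are eventually equal to $x$ and the corresponding terms of the series vanish.) *)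

theory Defs
  imports "HOL-Analysis.Analysis"
begin

text \<open>
  Partial quotients are extended reals, since the expansion of a rational number ends in
  infinite partial quotients. The arithmetic of \<^typ>\<open>ereal\<close> satisfies the usual conventions
  \<open>1 / \<infinity> = 0\<close>, \<open>\<infinity> + c = \<infinity>\<close> and \<open>\<infinity> + \<infinity> = \<infinity>\<close>.
\<close>

definition cf_first :: "real \<Rightarrow> ereal" where
  "cf_first y = (if y = 0 then \<infinity> else ereal (of_int \<lfloor>1 / y\<rfloor>))"

definition gauss_map :: "real \<Rightarrow> real" where
  "gauss_map y = (if y = 0 then 0 else 1 / y - of_int \<lfloor>1 / y\<rfloor>)"

definition cf_digit :: "real \<Rightarrow> nat \<Rightarrow> ereal" where
  "cf_digit x n =
     (if n = 0 then ereal (of_int \<lfloor>x\<rfloor>)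
      else cf_first ((gauss_map ^^ (n - 1)) (x - of_int \<lfloor>x\<rfloor>)))"

text \<open>
  \<open>cf_value [a\<^sub>0, \<dots>, a\<^sub>n]\<close> is the infinite expansion \<open>[a\<^sub>0; a\<^sub>1, \<dots>, a\<^sub>n, \<infinity>, \<infinity>, \<dots>]\<close>: the empty
  list stands for the tail \<open>\<infinity> + 1 / (\<infinity> + \<dots>) = \<infinity>\<close>.
\<close>

fun cf_value :: "ereal list \<Rightarrow> ereal" where
  "cf_value [] = \<infinity>"
| "cf_value (a # as) = a + 1 / cf_value as"

definition cf_convergent :: "real \<Rightarrow> nat \<Rightarrow> int \<times> int" where
  "cf_convergent x n =
     (THE (p, q). q \<ge> 1 \<and> coprime p q \<and>
        ereal (of_int p / of_int q) = cf_value (map (cf_digit x) [0..<Suc n]))"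

definition cf_num :: "real \<Rightarrow> nat \<Rightarrow> int" where
  "cf_num x n = fst (cf_convergent x n)"

definition cf_den :: "real \<Rightarrow> nat \<Rightarrow> int" where
  "cf_den x n = snd (cf_convergent x n)"

definition error_sum :: "real \<Rightarrow> real" where
  "error_sum x = (\<Sum>n. x - of_int (cf_num x n) / of_int (cf_den x n))"

text \<open>
  The summand \<open>|U|\<^sup>s\<close> of the Hausdorff measure, for bounded \<open>U\<close> and \<open>s \<ge> 0\<close>. The case \<open>s = 0\<close> is
  separate because \<open>0 powr 0 = 0\<close>, whereas a nonempty set contributes \<open>1\<close> to the
  \<open>0\<close>-dimensional measure even if it is a single point.
\<close>

definition diam_powr :: "real \<Rightarrow> 'a::metric_space set \<Rightarrow> ennreal" where
  "diam_powr s U =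
     (if U = {} then 0 else if s = 0 then 1 else ennreal (diameter U powr s))"

text \<open>
  Covers by countably many sets, a finite cover being padded with empty sets. Boundedness is
  demanded explicitly because \<^const>\<open>diameter\<close> is unspecified on unbounded sets.
\<close>

definition hausdorff_premeasure :: "real \<Rightarrow> real \<Rightarrow> 'a::metric_space set \<Rightarrow> ennreal" where
  "hausdorff_premeasure s \<delta> A =
     (INF U \<in> {U :: nat \<Rightarrow> 'a set. A \<subseteq> (\<Union>i. U i) \<and> (\<forall>i. bounded (U i) \<and> diameter (U i) \<le> \<delta>)}.
        \<Sum>i. diam_powr s (U i))"

definition hausdorff_measure :: "real \<Rightarrow> 'a::metric_space set \<Rightarrow> ennreal" where
  "hausdorff_measure s A = (SUP \<delta> \<in> {0<..}. hausdorff_premeasure s \<delta> A)"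

definition hausdorff_dim :: "'a::metric_space set \<Rightarrow> ennreal" where
  "hausdorff_dim A = (INF s \<in> {s. s \<ge> 0 \<and> hausdorff_measure s A = 0}. ennreal s)"

end

theory Submission
  imports Defs "HOL-Real_Asymp.Real_Asymp"
begin

text \<open>
  Lower bound: the projection of the graph to the first axis is onto and does not increase
  diameters, so for \<open>s < 1\<close> the \<open>s\<close>-sum of any cover by sets of diameter at most \<open>1\<close> is at least the
  length of the unit interval.

  Upper bound: on the cylinder of numbers with prescribed digits \<open>d\<^sub>0, \<dots>, d\<^sub>n\<close>, the first \<open>n + 1\<close> terms
  of the series have slope \<open>1\<close>, and the remaining ones are bounded by \<open>1 / q\<^sub>k\<^sup>2\<close>, which decays
  geometrically in \<open>k\<close>. Hence the graph over the cylinder has diameter at most \<open>(2n + 12) / q\<^sub>n\<^sup>2\<close>,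
  and \<open>1 / q\<^sub>n\<^sup>2\<close> is at most twice the length of the cylinder. The cylinder lengths add up under
  subdivision and are exponentially small in \<open>n\<close>, so for \<open>s > 1\<close> the \<open>s\<close>-sum over all cylinders of depth \<open>n\<close> with the same
  \<open>d\<^sub>0\<close> is \<open>O((2n + 12)\<^sup>s 2\<^bsup>-n(s-1)\<^esup>)\<close>, which tends to \<open>0\<close>. The rational points form a countable set.
\<close>

subsection \<open>Hausdorff premeasures\<close>

lemma hausdorff_premeasure_le_sum:
  assumes "A \<subseteq> (\<Union>i. U i)" "\<And>i. bounded (U i)" "\<And>i. diameter (U i) \<le> \<delta>"
  shows "hausdorff_premeasure s \<delta> A \<le> (\<Sum>i. diam_powr s (U i))"
  unfolding hausdorff_premeasure_def using assms by (intro INF_lower) auto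

text \<open>\<open>A\<close> covers itself, padded with empty sets. With \<open>s = 0\<close> a
  single point would contribute 1 while \<open>0 powr 0 = 0\<close>, hence
  \<open>s > 0\<close>.\<close>

lemma hausdorff_premeasure_le_powr:
  assumes "bounded A" "diameter A \<le> \<delta>" "0 \<le> \<delta>" "s > 0"
  shows "hausdorff_premeasure s \<delta> A \<le> ennreal (diameter A powr s)"
proof -
  define U where "U i = (if i = (0::nat) then A else {})" for i
  have "hausdorff_premeasure s \<delta> A \<le> (\<Sum>i. diam_powr s (U i))"
    by (rule hausdorff_premeasure_le_sum) (use assms in \<open>auto simp: U_def\<close>)
  also have "\<dots> = (\<Sum>i\<in>{0}. diam_powr s (U i))"
    by (rule suminf_finite) (auto simp: U_def diam_powr_def)
  also have "\<dots> \<le> ennreal (diameter A powr s)"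
    using assms by (auto simp: U_def diam_powr_def)
  finally show ?thesis .
qed

lemma hausdorff_premeasure_mono:
  assumes "A \<subseteq> B"
  shows "hausdorff_premeasure s \<delta> A \<le> hausdorff_premeasure s \<delta> B"
  unfolding hausdorff_premeasure_def using assms by (intro INF_superset_mono) auto

text \<open>Near-optimal covers of the \<open>A i\<close>, with excess \<open>e / 2 ^ Suc i\<close>,
  are merged into one sequence by the pairing function; the excesses add up to
  \<open>e\<close>.\<close>

lemma hausdorff_premeasure_countable_subadditive:
  fixes A :: "nat \<Rightarrow> 'a::metric_space set"
  shows "hausdorff_premeasure s \<delta> (\<Union>i. A i) \<le> (\<Sum>i. hausdorff_premeasure s \<delta> (A i))"
proof (rule ennreal_le_epsilon)
  fix e :: real
  assume fin: "(\<Sum>i. hausdorff_premeasure s \<delta> (A i)) < top" and e: "0 < e"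
  have "\<exists>U. A i \<subseteq> (\<Union>j. U j) \<and> (\<forall>j. bounded (U j) \<and> diameter (U j) \<le> \<delta>) \<and>
    (\<Sum>j. diam_powr s (U j)) \<le> hausdorff_premeasure s \<delta> (A i) + ennreal (e * (1/2) ^ Suc i)" for i
  proof -
    have "hausdorff_premeasure s \<delta> (A i) \<noteq> top"
      using fin by (metis ennreal_suminf_lessD less_top)
    \<comment> \<open>Finiteness makes the inequality strict, so some cover comes this close to the
      infimum.\<close>
    then have "hausdorff_premeasure s \<delta> (A i) <
      hausdorff_premeasure s \<delta> (A i) + ennreal (e * (1/2) ^ Suc i)"
      using e by (simp add: ennreal_add_left_cancel_less[of _ 0, simplified] less_top)
    then show ?thesis
      unfolding hausdorff_premeasure_def[of s \<delta> "A i"] INF_less_iff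
      by (auto intro: less_imp_le)
  qed
  then obtain U where U: "\<And>i. A i \<subseteq> (\<Union>j. U i j)" "\<And>i j. bounded (U i j)"
    "\<And>i j. diameter (U i j) \<le> \<delta>"
    "\<And>i. (\<Sum>j. diam_powr s (U i j)) \<le> hausdorff_premeasure s \<delta> (A i) + ennreal (e * (1/2) ^ Suc i)"
    by metis
  have "hausdorff_premeasure s \<delta> (\<Union>i. A i) \<le> (\<Sum>k. diam_powr s (case_prod U (prod_decode k)))"
  proof (rule hausdorff_premeasure_le_sum)
    show "(\<Union>i. A i) \<subseteq> (\<Union>k. case_prod U (prod_decode k))"
    proof
      fix x assume "x \<in> (\<Union>i. A i)"
      then obtain i j where "x \<in> U i j" using U(1) by blast
      then have "x \<in> case_prod U (prod_decode (prod_encode (i, j)))" by simp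
      then show "x \<in> (\<Union>k. case_prod U (prod_decode k))" by (rule UN_I[OF UNIV_I])
    qed
  qed (auto simp: U split: prod.split)
  also have "\<dots> = (\<Sum>i. \<Sum>j. diam_powr s (U i j))"
    using suminf_ennreal_2dimen[of "\<lambda>i. \<Sum>j. diam_powr s (U i j)" "\<lambda>p. diam_powr s (case_prod U p)"]
    by simp
  also have "\<dots> \<le> (\<Sum>i. hausdorff_premeasure s \<delta> (A i) + ennreal (e * (1/2) ^ Suc i))"
    by (intro suminf_le U) auto
  also have "\<dots> = (\<Sum>i. hausdorff_premeasure s \<delta> (A i)) + (\<Sum>i. ennreal (e * (1/2) ^ Suc i))"
    by (rule suminf_add[symmetric]) auto
  also have "(\<Sum>i. ennreal (e * (1/2) ^ Suc i)) = ennreal (e * 1)"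
    using e by (intro suminf_ennreal_eq sums_mult power_half_series) auto
  finally show "hausdorff_premeasure s \<delta> (\<Union>i. A i) \<le>
    (\<Sum>i. hausdorff_premeasure s \<delta> (A i)) + ennreal e" by simp
qed

lemma hausdorff_premeasure_UN_eq_0:
  assumes "countable I" "\<And>i. i \<in> I \<Longrightarrow> hausdorff_premeasure s \<delta> (A i) = 0" "0 \<le> \<delta>" "s > 0"
  shows "hausdorff_premeasure s \<delta> (\<Union>i\<in>I. A i) = 0"
proof -
  \<comment> \<open>An enumeration of \<open>I\<close>, possibly with repetitions; an empty
    \<open>I\<close> is replaced by a sequence of empty sets.\<close>
  define B where "B n = (if I = {} then {} else A (from_nat_into I n))" for n
  have "hausdorff_premeasure s \<delta> (B n) = 0" for n
    using assms hausdorff_premeasure_le_powr[of "{}" \<delta> s]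
    by (auto simp: B_def from_nat_into)
  moreover have "(\<Union>i\<in>I. A i) \<subseteq> (\<Union>n. B n)"
    using assms(1) by (auto simp: B_def) (metis from_nat_into_surj)
  ultimately show ?thesis
    using hausdorff_premeasure_mono[of "\<Union>i\<in>I. A i" "\<Union>n. B n" s \<delta>]
      hausdorff_premeasure_countable_subadditive[of s \<delta> B] by simp
qed

section \<open>Lower bound by projection to the first axis\<close>

text \<open>The interval from \<open>Inf S\<close> to \<open>Sup S\<close> serves. A superset is
  taken because projections of arbitrary covering sets may fail to be measurable.\<close>

lemma bounded_real_set_measurable_superset:
  fixes S :: "real set"
  assumes "bounded S"
  shows "\<exists>T \<in> sets lborel. S \<subseteq> T \<and> emeasure lborel T \<le> ennreal (diameter S)"
proof (cases "S = {}")
  case False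
  have b: "bdd_above S" "bdd_below S"
    using assms by (auto simp: bounded_imp_bdd_above bounded_imp_bdd_below)
  have "Sup S \<le> diameter S + Inf S"
  proof (rule cSup_least[OF False])
    fix x assume x: "x \<in> S"
    have "x - diameter S \<le> Inf S"
      using diameter_bounded_bound[OF assms x] by (intro cInf_greatest[OF False]) (force simp: dist_real_def)
    then show "x \<le> diameter S + Inf S" by simp
  qed
  moreover have "Inf S \<le> Sup S" using False b by (metis cInf_le_cSup)
  ultimately have "emeasure lborel {Inf S..Sup S} \<le> ennreal (diameter S)"
    by (simp add: ennreal_leI)
  moreover have "S \<subseteq> {Inf S..Sup S}"
    using b by (auto intro: cInf_lower cSup_upper)
  ultimately show ?thesis by (intro bexI[of _ "{Inf S..Sup S}"]) auto
qed auto

lemma hausdorff_premeasure_graph_ge_1: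
  assumes "0 \<le> s" "s < 1"
  shows "hausdorff_premeasure s 1 {(x, f x) | x :: real. True} \<ge> 1"
  unfolding hausdorff_premeasure_def
proof (rule INF_greatest)
  fix U :: "nat \<Rightarrow> (real \<times> 'a) set"
  assume "U \<in> {U. {(x, f x) | x. True} \<subseteq> (\<Union>i. U i) \<and> (\<forall>i. bounded (U i) \<and> diameter (U i) \<le> 1)}"
  then have cov: "{(x, f x) | x. True} \<subseteq> (\<Union>i. U i)" and b: "\<And>i. bounded (U i)"
    and d1: "\<And>i. diameter (U i) \<le> 1" by auto
  have "\<exists>T \<in> sets lborel. fst ` U i \<subseteq> T \<and> emeasure lborel T \<le> diam_powr s (U i)" for i
  proof (cases "U i = {}")
    case False
    have "diameter (fst ` U i) \<le> diameter (U i)"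
    proof (rule diameter_le)
      fix a b' assume "a \<in> fst ` U i" "b' \<in> fst ` U i"
      then obtain p q where pq: "p \<in> U i" "q \<in> U i" "a = fst p" "b' = fst q" by auto
      have "dist (fst p) (fst q) \<le> dist p q" by (rule dist_fst_le)
      also have "\<dots> \<le> diameter (U i)" using pq b by (intro diameter_bounded_bound)
      finally show "norm (a - b') \<le> diameter (U i)" using pq by (simp add: dist_norm)
    qed (use False in auto)
    \<comment> \<open>Here the bound 1 on diameters enters: lowering the exponent from 1 to
      \<open>s\<close> can only increase a power of a number in (0, 1].\<close>
    moreover have "ennreal (diameter (U i)) \<le> diam_powr s (U i)"
    proof (cases "s = 0 \<or> diameter (U i) = 0")
      case True
      then show ?thesis using False d1[of i] by (auto simp: diam_powr_def ennreal_le_1)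
    next
      case False
      then have pos: "0 < diameter (U i)" using diameter_ge_0[OF b[of i]] by simp
      have "diameter (U i) powr 1 \<le> diameter (U i) powr s"
        using pos d1[of i] assms by (intro powr_mono') auto
      then show ?thesis using False pos \<open>U i \<noteq> {}\<close> by (auto simp: diam_powr_def ennreal_leI)
    qed
    ultimately have "ennreal (diameter (fst ` U i)) \<le> diam_powr s (U i)"
      by (meson ennreal_leI order_trans)
    then show ?thesis
      using bounded_real_set_measurable_superset[OF bounded_fst[OF b[of i]]] order_trans by blast
  qed (auto intro!: bexI[of _ "{}"])
  then obtain T where T: "\<And>i. T i \<in> sets lborel" "\<And>i. fst ` U i \<subseteq> T i"
    "\<And>i. emeasure lborel (T i) \<le> diam_powr s (U i)" by metis
  have "{0..1} \<subseteq> (\<Union>i. T i)"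
  proof
    fix x :: real
    have "(x, f x) \<in> (\<Union>i. U i)" using cov by auto
    then obtain i where "(x, f x) \<in> U i" by auto
    then have "fst (x, f x) \<in> T i" using T(2) by blast
    then show "x \<in> (\<Union>i. T i)" by auto
  qed
  then have "emeasure lborel {0..1::real} \<le> emeasure lborel (\<Union>i. T i)"
    using T(1) by (intro emeasure_mono) auto
  also have "\<dots> \<le> (\<Sum>i. emeasure lborel (T i))"
    using T(1) by (intro emeasure_subadditive_countably) auto
  also have "\<dots> \<le> (\<Sum>i. diam_powr s (U i))" by (intro suminf_le T) auto
  finally show "1 \<le> (\<Sum>i. diam_powr s (U i))" by simp
qed

subsection \<open>Continuants and convergents\<close>

text \<open>
  Indices are shifted by one: \<open>contnum d (Suc n) / contden d (Suc n)\<close> is the \<open>n\<close>th convergent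
  \<open>p\<^sub>n / q\<^sub>n\<close>, and index \<open>0\<close> holds the formal convergent \<open>1 / 0\<close>.
\<close>

fun contnum :: "(nat \<Rightarrow> int) \<Rightarrow> nat \<Rightarrow> int" where
  "contnum d 0 = 1"
| "contnum d (Suc 0) = d 0"
| "contnum d (Suc (Suc n)) = d (Suc n) * contnum d (Suc n) + contnum d n"

fun contden :: "(nat \<Rightarrow> int) \<Rightarrow> nat \<Rightarrow> int" where
  "contden d 0 = 0"
| "contden d (Suc 0) = 1"
| "contden d (Suc (Suc n)) = d (Suc n) * contden d (Suc n) + contden d n"

lemma contnum_cong: "(\<And>k. k < n \<Longrightarrow> d k = d' k) \<Longrightarrow> contnum d n = contnum d' n"
  by (induction d n rule: contnum.induct) auto

lemma contden_cong: "(\<And>k. k < n \<Longrightarrow> d k = d' k) \<Longrightarrow> contden d n = contden d' n"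
  by (induction d n rule: contden.induct) auto

text \<open>The continuants at \<open>Suc n\<close> and \<open>n\<close> are the columns of a
  product of matrices with rows \<open>(d k, 1)\<close> and \<open>(1, 0)\<close>, each of
  determinant -1.\<close>

lemma continuant_det:
  "contnum d (Suc n) * contden d n - contnum d n * contden d (Suc n) = (-1) ^ Suc n"
  by (induction n) (auto simp: algebra_simps)

lemma coprime_continuants: "coprime (contnum d n) (contden d n)"
proof (rule coprimeI)
  fix c assume "c dvd contnum d n" "c dvd contden d n"
  then have "c dvd contnum d (Suc n) * contden d n - contnum d n * contden d (Suc n)"
    by (intro dvd_diff dvd_mult dvd_mult2)
  then have "c dvd (-1) ^ Suc n"
    by (simp only: continuant_det)
  then show "is_unit c"
    by (rule dvd_trans) simp
qed

text \<open>Nothing is assumed of \<open>d 0\<close>, which may be negative: it does not enter the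
  denominators.\<close>

lemma contden_nonneg_pos:
  assumes "\<And>k. 1 \<le> k \<Longrightarrow> k \<le> n \<Longrightarrow> d k \<ge> 1"
  shows "contden d n \<ge> 0 \<and> contden d (Suc n) \<ge> 1"
  using assms
proof (induction n)
  case (Suc n)
  then have "contden d n \<ge> 0" "contden d (Suc n) \<ge> 1" "d (Suc n) \<ge> 1"
    by auto
  moreover from this have "d (Suc n) * contden d (Suc n) \<ge> 1 * 1"
    by (intro mult_mono) auto
  ultimately show ?case by simp
qed auto

lemma contden_Suc_ge:
  assumes "\<And>k. 1 \<le> k \<Longrightarrow> k \<le> n \<Longrightarrow> d k \<ge> 1"
  shows "contden d n \<le> contden d (Suc n)"
proof (cases n)
  case (Suc m)
  have "contden d m \<ge> 0" "contden d (Suc m) \<ge> 1" "d n \<ge> 1"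
    using contden_nonneg_pos[of m d] assms Suc by auto
  then have "contden d m \<ge> 0" "1 * contden d (Suc m) \<le> d n * contden d (Suc m)"
    by (auto intro!: mult_right_mono)
  then show ?thesis unfolding Suc contden.simps by linarith
qed simp

lemma contden_double:
  assumes "\<And>k. 1 \<le> k \<Longrightarrow> k \<le> Suc n \<Longrightarrow> d k \<ge> 1"
  shows "2 * contden d n \<le> contden d (Suc (Suc n))"
proof -
  have "contden d n \<ge> 0" "contden d (Suc n) \<ge> 1" "d (Suc n) \<ge> 1"
    "contden d n \<le> contden d (Suc n)"
    using contden_nonneg_pos[of n d] contden_Suc_ge[of n d] assms by auto
  moreover from this have "1 * contden d (Suc n) \<le> d (Suc n) * contden d (Suc n)"
    by (intro mult_right_mono) auto
  ultimately show ?thesis unfolding contden.simps by linarith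
qed

text \<open>Two steps at least double the denominator, so its square grows by a factor of at least
  4. The induction therefore moves in steps of two, and the factor 2 on the right absorbs odd
  \<open>k\<close>.\<close>

lemma contden_growth:
  assumes "\<And>j. 1 \<le> j \<Longrightarrow> j \<le> n + k \<Longrightarrow> d j \<ge> 1"
  shows "2 ^ k * (contden d (Suc n))\<^sup>2 \<le> 2 * (contden d (Suc (n + k)))\<^sup>2"
  using assms
proof (induction k rule: nat_induct2)
  case 1
  have "contden d (Suc n) \<le> contden d (Suc (Suc n))"
    by (rule contden_Suc_ge) (use 1 in auto)
  then have "(contden d (Suc n))\<^sup>2 \<le> (contden d (Suc (Suc n)))\<^sup>2"
    using contden_nonneg_pos[of n d] 1 by (intro power_mono) auto
  then show ?case by simp
next
  case (step k)
  have "2 * contden d (Suc (n + k)) \<le> contden d (Suc (Suc (Suc (n + k))))"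
    by (rule contden_double) (use step.prems in auto)
  then have "(2 * contden d (Suc (n + k)))\<^sup>2 \<le> (contden d (Suc (Suc (Suc (n + k)))))\<^sup>2"
    using contden_nonneg_pos[of "n + k" d] step.prems by (intro power_mono) auto
  moreover have "2 ^ k * (contden d (Suc n))\<^sup>2 \<le> 2 * (contden d (Suc (n + k)))\<^sup>2"
    using step by simp
  ultimately show ?case by (simp add: power_mult_distrib del: contden.simps)
qed simp

lemma cf_value_merge:
  "y > 0 \<Longrightarrow> cf_value (as @ [ereal a, ereal y]) = cf_value (as @ [ereal (a + 1 / y)])"
  by (induction as) (auto simp: one_ereal_def)

text \<open>The last entry is an arbitrary positive real so that the induction can fold the last two
  entries into one, replacing \<open>y\<close> by \<open>d (Suc n) + 1 / y\<close>.\<close>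

lemma cf_value_snoc:
  assumes "\<And>k. 1 \<le> k \<Longrightarrow> d k \<ge> 1" "y > 0"
  shows "cf_value (map (\<lambda>k. ereal (of_int (d k))) [0..<Suc n] @ [ereal y]) =
    ereal ((y * contnum d (Suc n) + contnum d n) / (y * contden d (Suc n) + contden d n))"
  using assms(2)
proof (induction n arbitrary: y)
  case 0
  then show ?case by (simp add: one_ereal_def divide_simps)
next
  case (Suc n)
  have d: "d (Suc n) \<ge> 1" using assms by simp
  have q: "contden d n \<ge> 0" "contden d (Suc n) \<ge> 1"
    using contden_nonneg_pos[of n d] assms by auto
  have y': "d (Suc n) + 1 / y > 0" using d Suc.prems by (simp add: add_pos_pos)
  have pos: "y * (d (Suc n) * contden d (Suc n) + contden d n) + contden d (Suc n) > 0"
  proof -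
    have "real_of_int (d (Suc n) * contden d (Suc n) + contden d n) \<ge> 0"
      using d q by auto
    then show ?thesis using Suc.prems q by (intro add_nonneg_pos) auto
  qed
  have pos2: "(d (Suc n) + 1 / y) * contden d (Suc n) + contden d n > 0"
    using y' q by (intro add_pos_nonneg mult_pos_pos[OF y']) auto
  have "cf_value (map (\<lambda>k. ereal (of_int (d k))) [0..<Suc (Suc n)] @ [ereal y]) =
    cf_value (map (\<lambda>k. ereal (of_int (d k))) [0..<Suc n] @ [ereal (d (Suc n)), ereal y])"
    by simp
  also have "\<dots> = cf_value (map (\<lambda>k. ereal (of_int (d k))) [0..<Suc n] @ [ereal (d (Suc n) + 1 / y)])"
    by (rule cf_value_merge) (use Suc.prems in auto)
  also have "\<dots> = ereal (((d (Suc n) + 1 / y) * contnum d (Suc n) + contnum d n) /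
      ((d (Suc n) + 1 / y) * contden d (Suc n) + contden d n))"
    by (rule Suc.IH) (rule y')
  \<comment> \<open>Expanding by \<open>y\<close> clears the inner fraction and exposes the
    recurrence of the continuants.\<close>
  also have "((d (Suc n) + 1 / y) * contnum d (Suc n) + contnum d n) /
      ((d (Suc n) + 1 / y) * contden d (Suc n) + contden d n) =
     (y * ((d (Suc n) + 1 / y) * contnum d (Suc n) + contnum d n)) /
      (y * ((d (Suc n) + 1 / y) * contden d (Suc n) + contden d n))"
    using Suc.prems by simp
  also have "\<dots> = (y * contnum d (Suc (Suc n)) + contnum d (Suc n)) / (y * contden d (Suc (Suc n)) + contden d (Suc n))"
    using Suc.prems by (simp add: algebra_simps)
  finally show ?case .
qed

text \<open>The last digit plays the real entry of \<open>cf_value_snoc\<close>;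
  \<open>n = 0\<close> is separate because \<open>d 0\<close> need not be positive.\<close>

lemma cf_value_eq:
  assumes "\<And>k. 1 \<le> k \<Longrightarrow> d k \<ge> 1"
  shows "cf_value (map (\<lambda>k. ereal (of_int (d k))) [0..<Suc n]) =
    ereal (contnum d (Suc n) / contden d (Suc n))"
proof (cases n)
  case (Suc m)
  have "d (Suc m) \<ge> 1" using assms by simp
  then have "real_of_int (d (Suc m)) > 0" by simp
  from cf_value_snoc[of d, OF assms this, of m] Suc show ?thesis by simp
qed simp

text \<open>Provides the uniqueness required by the definite description in
  \<open>cf_convergent\<close>.\<close>

lemma coprime_fraction_unique:
  fixes p q p' q' :: int
  assumes "coprime p q" "coprime p' q'" "q \<ge> 1" "q' \<ge> 1" "real_of_int p / q = p' / q'"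
  shows "p = p' \<and> q = q'"
proof -
  have "real_of_int p * q' = p' * q"
    using assms(3-5) by (simp add: field_simps)
  then have eq: "p * q' = p' * q" by (metis of_int_eq_iff of_int_mult)
  then have "q dvd q'" "q' dvd q"
    using assms(1,2) by (metis coprime_commute coprime_dvd_mult_right_iff dvd_triv_right)+
  then have "q = q'" using assms(3,4) by (simp add: zdvd_antisym_nonneg)
  with eq assms(3) show ?thesis by simp
qed

section \<open>Digits, remainders and convergents of irrational numbers\<close>

definition cf_rem :: "real \<Rightarrow> nat \<Rightarrow> real" where
  "cf_rem x n = (gauss_map ^^ n) (frac x)"

text \<open>Integer-valued counterpart of \<open>cf_digit\<close>, meant for irrational
  \<open>x\<close>, where no digit is infinite.\<close>

definition cf_idigit :: "real \<Rightarrow> nat \<Rightarrow> int" where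
  "cf_idigit x n = (if n = 0 then \<lfloor>x\<rfloor> else \<lfloor>1 / cf_rem x (n - 1)\<rfloor>)"

lemma frac_irrational: "x \<notin> \<rat> \<Longrightarrow> frac x \<notin> \<rat> \<and> 0 < frac x \<and> frac x < 1"
proof -
  assume x: "x \<notin> \<rat>"
  have "frac x \<notin> \<rat>"
  proof
    assume "frac x \<in> \<rat>"
    then have "frac x + of_int \<lfloor>x\<rfloor> \<in> \<rat>" by (intro Rats_add) auto
    with x show False by (simp add: frac_def)
  qed
  moreover from this have "frac x \<noteq> 0" by (metis Rats_0)
  ultimately show ?thesis using frac_ge_0[of x] frac_lt_1[of x] by linarith
qed

text \<open>The Gauss map preserves irrationality, so the orbit never reaches 0 and the expansion
  does not terminate.\<close>

lemma cf_rem_irrational: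
  assumes "x \<notin> \<rat>"
  shows "cf_rem x n \<notin> \<rat> \<and> 0 < cf_rem x n \<and> cf_rem x n < 1"
proof (induction n)
  case 0
  show ?case using frac_irrational[OF assms] by (simp add: cf_rem_def)
next
  case (Suc n)
  then have "1 / cf_rem x n \<notin> \<rat>"
    by (metis Rats_1 Rats_divide div_by_1 divide_divide_eq_right mult_1)
  from frac_irrational[OF this] Suc show ?case
    by (simp add: cf_rem_def gauss_map_def frac_def)
qed

lemma cf_rem_Suc:
  assumes "x \<notin> \<rat>"
  shows "cf_rem x n * (cf_idigit x (Suc n) + cf_rem x (Suc n)) = 1"
  using cf_rem_irrational[OF assms, of n]
  by (simp add: cf_idigit_def cf_rem_def gauss_map_def)

lemma cf_idigit_ge_1:
  assumes "x \<notin> \<rat>" "1 \<le> n"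
  shows "cf_idigit x n \<ge> 1"
  using cf_rem_irrational[OF assms(1), of "n - 1"] assms(2) by (simp add: cf_idigit_def)

lemma cf_digit_irrational:
  assumes "x \<notin> \<rat>"
  shows "cf_digit x n = ereal (of_int (cf_idigit x n))"
  using cf_rem_irrational[OF assms, of "n - 1"]
  by (auto simp: cf_digit_def cf_first_def cf_idigit_def cf_rem_def frac_def)

lemma cf_convergent_irrational:
  assumes "x \<notin> \<rat>"
  shows "cf_convergent x n = (contnum (cf_idigit x) (Suc n), contden (cf_idigit x) (Suc n))"
proof -
  let ?d = "cf_idigit x"
  have d: "\<And>k. 1 \<le> k \<Longrightarrow> ?d k \<ge> 1" using cf_idigit_ge_1[OF assms] .
  have "cf_digit x = (\<lambda>k. ereal (of_int (?d k)))"
    using cf_digit_irrational[OF assms] by (rule ext)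
  then have v: "cf_value (map (cf_digit x) [0..<Suc n]) = ereal (contnum ?d (Suc n) / contden ?d (Suc n))"
    using cf_value_eq[of ?d n, OF d] by (simp only:)
  have q: "contden ?d (Suc n) \<ge> 1" using contden_nonneg_pos[of n ?d] d by auto
  show ?thesis
    unfolding cf_convergent_def v
    using q coprime_continuants[of ?d "Suc n"] coprime_fraction_unique
    by (intro the_equality) (auto simp del: contnum.simps contden.simps)
qed

text \<open>This is x = [d_0; d_1, ..., d_n + t_n] with t_n = \<open>cf_rem x n\<close>, cleared of
  denominators. The induction substitutes t_n = 1 / (d_(n+1) + t_(n+1)).\<close>

lemma cf_remainder_identity:
  assumes "x \<notin> \<rat>"
  shows "x * (contden (cf_idigit x) (Suc n) + contden (cf_idigit x) n * cf_rem x n) =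
    contnum (cf_idigit x) (Suc n) + contnum (cf_idigit x) n * cf_rem x n"
proof (induction n)
  case 0
  show ?case by (simp add: cf_idigit_def cf_rem_def frac_def)
next
  case (Suc n)
  define t where "t = cf_rem x n"
  define u where "u = cf_rem x (Suc n)"
  define a where "a = cf_idigit x (Suc n)"
  have tu: "t * (a + u) = 1" using cf_rem_Suc[OF assms] by (simp add: t_def u_def a_def)
  note IH = Suc.IH[folded t_def]
  \<comment> \<open>Since \<open>t * (a + u) = 1\<close>, advancing the index amounts to multiplying
    by \<open>a + u\<close>, for numerators and denominators alike.\<close>
  have *: "real_of_int (c (Suc n)) * (a + u) + c n = (a + u) * (c (Suc n) + c n * t)" for c :: "nat \<Rightarrow> int"
  proof -
    have "(a + u) * (c (Suc n) + c n * t) = real_of_int (c (Suc n)) * (a + u) + c n * (t * (a + u))"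
      by (simp only: algebra_simps)
    then show ?thesis by (simp add: tu)
  qed
  have "x * (contden (cf_idigit x) (Suc n) * (a + u) + contden (cf_idigit x) n) =
     (a + u) * (x * (contden (cf_idigit x) (Suc n) + contden (cf_idigit x) n * t))"
    unfolding * by simp
  also have "\<dots> = contnum (cf_idigit x) (Suc n) * (a + u) + contnum (cf_idigit x) n"
    unfolding IH * by simp
  finally show ?case by (simp add: a_def u_def algebra_simps)
qed

lemma convergent_error:
  assumes "x \<notin> \<rat>"
  shows "\<bar>x - contnum (cf_idigit x) (Suc n) / contden (cf_idigit x) (Suc n)\<bar>
    \<le> 1 / (contden (cf_idigit x) (Suc n))\<^sup>2"
proof -
  define p q p' q' t where defs: "p = real_of_int (contnum (cf_idigit x) (Suc n))"
    "q = real_of_int (contden (cf_idigit x) (Suc n))" "p' = real_of_int (contnum (cf_idigit x) n)"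
    "q' = real_of_int (contden (cf_idigit x) n)" "t = cf_rem x n"
  have q: "q \<ge> 1" "q' \<ge> 0"
    using contden_nonneg_pos[of n "cf_idigit x"] cf_idigit_ge_1[OF assms] by (auto simp: defs)
  have t: "0 < t" "t < 1" using cf_rem_irrational[OF assms] by (auto simp: defs)
  have x: "x * (q + q' * t) = p + p' * t"
    using cf_remainder_identity[OF assms, of n] by (simp add: defs)
  have "p * q' - p' * q = of_int (contnum (cf_idigit x) (Suc n) * contden (cf_idigit x) n -
     contnum (cf_idigit x) n * contden (cf_idigit x) (Suc n))"
    by (simp add: defs)
  also have "\<dots> = (-1) ^ Suc n" by (simp only: continuant_det) simp
  finally have det: "\<bar>p * q' - p' * q\<bar> = 1" by simp
  have D: "q + q' * t \<ge> q" "q + q' * t > 0" using q t by (auto intro: add_pos_nonneg)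
  \<comment> \<open>By the determinant identity the right-hand side is \<open>t\<close> up to sign,
    so the error is exactly \<open>t / (q * (q + q' * t))\<close> in absolute value.\<close>
  have "(x - p / q) * (q * (q + q' * t)) = t * (p' * q - p * q')"
  proof -
    have "(x - p / q) * (q * (q + q' * t)) = q * (x * (q + q' * t)) - p * (q + q' * t)"
      using q by (simp add: field_simps)
    then show ?thesis unfolding x by (simp add: algebra_simps)
  qed
  then have "\<bar>(x - p / q) * (q * (q + q' * t))\<bar> = \<bar>t * (p' * q - p * q')\<bar>"
    by (rule arg_cong)
  then have "\<bar>x - p / q\<bar> * (q * (q + q' * t)) = t"
    using D q t det by (simp add: abs_mult abs_minus_commute)
  then have "\<bar>x - p / q\<bar> * (q * (q + q' * t)) \<le> 1" using t by simp
  moreover have "\<bar>x - p / q\<bar> * (q * q) \<le> \<bar>x - p / q\<bar> * (q * (q + q' * t))"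
    using D q by (intro mult_left_mono) auto
  ultimately have "\<bar>x - p / q\<bar> * (q * q) \<le> 1" by linarith
  then have "\<bar>x - p / q\<bar> \<le> 1 / q\<^sup>2"
    using q by (simp add: power2_eq_square pos_le_divide_eq)
  then show ?thesis by (simp add: defs)
qed

subsection \<open>Cylinders\<close>

lemma error_sum_irrational:
  assumes "x \<notin> \<rat>"
  shows "error_sum x = (\<Sum>n. x - contnum (cf_idigit x) (Suc n) / contden (cf_idigit x) (Suc n))"
  by (simp only: error_sum_def cf_num_def cf_den_def cf_convergent_irrational[OF assms] fst_conv snd_conv)

text \<open>The errors past \<open>n\<close> are dominated by a geometric series with ratio 1/2,
  because the squared denominators grow as in \<open>contden_growth\<close>.\<close>

lemma error_sum_tail:
  assumes "x \<notin> \<rat>"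
  shows "\<bar>error_sum x - (\<Sum>k\<le>n. x - contnum (cf_idigit x) (Suc k) / contden (cf_idigit x) (Suc k))\<bar>
    \<le> 4 / (contden (cf_idigit x) (Suc n))\<^sup>2"
proof -
  define e where "e k = x - contnum (cf_idigit x) (Suc k) / contden (cf_idigit x) (Suc k)" for k
  define q where "q k = real_of_int (contden (cf_idigit x) (Suc k))" for k
  have d: "\<And>k. 1 \<le> k \<Longrightarrow> cf_idigit x k \<ge> 1" using cf_idigit_ge_1[OF assms] .
  have q: "q k \<ge> 1" for k
    using contden_nonneg_pos[of k "cf_idigit x"] d by (auto simp: q_def)
  have grow: "2 ^ k * (q m)\<^sup>2 \<le> 2 * (q (m + k))\<^sup>2" for k m
  proof -
    have "real_of_int (2 ^ k * (contden (cf_idigit x) (Suc m))\<^sup>2) \<le>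
      real_of_int (2 * (contden (cf_idigit x) (Suc (m + k)))\<^sup>2)"
      using contden_growth[of m k "cf_idigit x", OF d] by (simp only: of_int_le_iff)
    then show ?thesis by (simp add: q_def del: contden.simps)
  qed
  have e: "\<bar>e (m + k)\<bar> \<le> 2 / (q m)\<^sup>2 * (1 / 2) ^ k" for m k
  proof -
    have "\<bar>e (m + k)\<bar> \<le> 1 / (q (m + k))\<^sup>2"
      using convergent_error[OF assms, of "m + k"] by (simp add: e_def q_def del: contden.simps contnum.simps)
    also have "\<dots> \<le> 2 / (2 ^ k * (q m)\<^sup>2)"
      using grow[of k m] q[of m] q[of "m + k"] by (simp add: divide_simps)
    finally show ?thesis by (simp add: power_one_over field_simps)
  qed
  have sm: "summable (\<lambda>k. 2 / (q m)\<^sup>2 * (1 / 2) ^ k)" for m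
    by (intro summable_mult summable_geometric) simp
  have se: "summable (\<lambda>k. \<bar>e (m + k)\<bar>)" for m
    by (rule summable_comparison_test'[OF sm[of m], of 0]) (use e in auto)
  from summable_rabs_cancel[OF se[of 0]] have "summable e" by simp
  then have "suminf e - (\<Sum>k\<le>n. e k) = (\<Sum>k. e (k + Suc n))"
    by (simp only: suminf_minus_initial_segment lessThan_Suc_atMost)
  then have "\<bar>suminf e - (\<Sum>k\<le>n. e k)\<bar> \<le> (\<Sum>k. \<bar>e (k + Suc n)\<bar>)"
    using summable_rabs[of "\<lambda>k. e (k + Suc n)"] se[of "Suc n"] by (simp add: add.commute)
  \<comment> \<open>The tail starts at \<open>Suc n\<close>; the additional factor 1/2 is given
    away, and the constant 4 is 2 times the geometric sum 2.\<close>
  also have "\<dots> \<le> (\<Sum>k. 2 / (q n)\<^sup>2 * (1 / 2) ^ k)"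
  proof (rule suminf_le[OF _ _ sm])
    fix k
    have "\<bar>e (n + Suc k)\<bar> \<le> 2 / (q n)\<^sup>2 * (1 / 2) ^ Suc k" by (rule e)
    also have "\<dots> \<le> 2 / (q n)\<^sup>2 * (1 / 2) ^ k"
      by (intro mult_left_mono) (auto simp: power_decreasing)
    finally show "\<bar>e (k + Suc n)\<bar> \<le> 2 / (q n)\<^sup>2 * (1 / 2) ^ k" by (simp add: add.commute)
  next
    show "summable (\<lambda>k. \<bar>e (k + Suc n)\<bar>)" using se[of "Suc n"] by (simp add: add.commute)
  qed
  also have "\<dots> = 2 / (q n)\<^sup>2 * (\<Sum>k. (1 / 2) ^ k)"
    by (intro suminf_mult summable_geometric) simp
  also have "(\<Sum>k. (1 / 2) ^ k) = (2 :: real)"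
    by (subst suminf_geometric) auto
  finally show ?thesis
    unfolding error_sum_irrational[OF assms] by (simp add: e_def[abs_def] q_def del: contden.simps contnum.simps)
qed

text \<open>Only the values of \<open>d\<close> up to \<open>n\<close> matter; a total function
  makes refinement an update at \<open>Suc n\<close>. Rational points are covered
  separately.\<close>

definition cf_cylinder :: "nat \<Rightarrow> (nat \<Rightarrow> int) \<Rightarrow> real set" where
  "cf_cylinder n d = {x. x \<notin> \<rat> \<and> (\<forall>k\<le>n. cf_idigit x k = d k)}"

text \<open>
  The distance \<open>1 / (q\<^sub>n (q\<^sub>n + q\<^sub>n\<^sub>-\<^sub>1))\<close> between the end points of the cylinder.
\<close>

definition cylinder_length :: "nat \<Rightarrow> (nat \<Rightarrow> int) \<Rightarrow> real" where
  "cylinder_length n d = 1 / (contden d (Suc n) * (contden d (Suc n) + contden d n))"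

lemma cf_cylinder_continuants:
  assumes "x \<in> cf_cylinder n d" "k \<le> Suc n"
  shows "contnum (cf_idigit x) k = contnum d k" "contden (cf_idigit x) k = contden d k"
  using assms by (auto intro!: contnum_cong contden_cong simp: cf_cylinder_def)

lemma cf_cylinder_dist:
  assumes x: "x \<in> cf_cylinder n d" and y: "y \<in> cf_cylinder n d"
  shows "dist (x, error_sum x) (y, error_sum y) \<le> (2 * n + 12) / (contden d (Suc n))\<^sup>2"
proof -
  have xi: "x \<notin> \<rat>" "y \<notin> \<rat>" using x y by (auto simp: cf_cylinder_def)
  define q where "q = real_of_int ((contden d (Suc n))\<^sup>2)"
  define S where "S z = (\<Sum>k\<le>n. z - contnum d (Suc k) / contden d (Suc k))" for z :: real
  note eqs = cf_cylinder_continuants[OF x] cf_cylinder_continuants[OF y]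
  have "\<bar>x - contnum d (Suc n) / contden d (Suc n)\<bar> \<le> 1 / q"
    "\<bar>y - contnum d (Suc n) / contden d (Suc n)\<bar> \<le> 1 / q"
    using convergent_error[OF xi(1), of n] convergent_error[OF xi(2), of n]
    by (simp_all add: eqs q_def del: contden.simps contnum.simps)
  then have xy: "\<bar>x - y\<bar> \<le> 2 / q" by (simp add: abs_le_iff)
  have E: "\<bar>error_sum x - S x\<bar> \<le> 4 / q" "\<bar>error_sum y - S y\<bar> \<le> 4 / q"
    using error_sum_tail[OF xi(1), of n] error_sum_tail[OF xi(2), of n]
    by (simp_all add: eqs q_def S_def del: contden.simps contnum.simps)
  \<comment> \<open>Both points share the convergents up to \<open>n\<close>, so these cancel in the
    difference.\<close>
  have "S x - S y = (n + 1) * (x - y)"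
    by (simp add: S_def sum_subtractf algebra_simps)
  then have "\<bar>S x - S y\<bar> = (n + 1) * \<bar>x - y\<bar>" by (simp add: abs_mult)
  also have "\<dots> \<le> (n + 1) * (2 / q)" by (intro mult_left_mono xy) auto
  finally have "\<bar>error_sum x - error_sum y\<bar> \<le> (n + 1) * (2 / q) + 4 / q + 4 / q"
    using E by linarith
  with xy have "\<bar>x - y\<bar> + \<bar>error_sum x - error_sum y\<bar> \<le> 2 / q + ((n + 1) * (2 / q) + 4 / q + 4 / q)"
    by linarith
  \<comment> \<open>The constant collects 2 from the first coordinate, \<open>2 * (n + 1)\<close>
    from the partial sums and 4 from each tail.\<close>
  also have "\<dots> = (2 * n + 12) / q" by (simp add: algebra_simps flip: add_divide_distrib)
  finally have "\<bar>x - y\<bar> + \<bar>error_sum x - error_sum y\<bar> \<le> (2 * n + 12) / q" .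
  moreover have "dist (x, error_sum x) (y, error_sum y) \<le> \<bar>x - y\<bar> + \<bar>error_sum x - error_sum y\<bar>"
    unfolding dist_Pair_Pair dist_real_def by (rule sqrt_sum_squares_le_sum_abs[THEN order_trans]) auto
  ultimately show ?thesis by (simp add: q_def del: contden.simps)
qed

text \<open>The child lengths telescope: their end points are the points where the next digit
  changes, and these accumulate at an end point of the parent. Digits are \<open>1 + int a\<close>
  because they start at 1.\<close>

lemma cylinder_length_split:
  assumes "\<And>k. 1 \<le> k \<Longrightarrow> k \<le> n \<Longrightarrow> d k \<ge> 1"
  shows "(\<lambda>a. cylinder_length (Suc n) (d(Suc n := 1 + int a))) sums cylinder_length n d"
proof -
  define q q' where defs: "q = real_of_int (contden d (Suc n))" "q' = real_of_int (contden d n)"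
  have q: "q \<ge> 1" "q' \<ge> 0" using contden_nonneg_pos[of n d] assms by (auto simp: defs)
  define f where "f a = 1 / (q * (real (Suc a) * q + q'))" for a
  have pos: "real (Suc a) * q + q' > 0" for a
    using q by (intro add_pos_nonneg) auto
  have "contden (d(Suc n := 1 + int a)) (Suc n) = contden d (Suc n)"
    "contden (d(Suc n := 1 + int a)) n = contden d n" for a
    by (auto intro: contden_cong)
  then have "cylinder_length (Suc n) (d(Suc n := 1 + int a)) =
      1 / ((real (Suc a) * q + q') * (real (Suc a) * q + q' + q))" for a
    by (simp add: cylinder_length_def defs)
  also have "\<dots> a = f a - f (Suc a)" for a
  proof -
    have "f a - f (Suc a) = (1 / q) * (1 / (real (Suc a) * q + q') - 1 / (real (Suc (Suc a)) * q + q'))"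
      by (simp add: f_def right_diff_distrib)
    also have "1 / (real (Suc a) * q + q') - 1 / (real (Suc (Suc a)) * q + q') =
        q / ((real (Suc a) * q + q') * (real (Suc (Suc a)) * q + q'))"
      using pos[of a] pos[of "Suc a"] by (subst diff_frac_eq) (auto simp: algebra_simps)
    finally show ?thesis using q by (simp add: algebra_simps)
  qed
  finally have eq: "cylinder_length (Suc n) (d(Suc n := 1 + int a)) = f a - f (Suc a)" for a .
  have "f \<longlonglongrightarrow> 0"
  proof -
    have "q > 0" using q by simp
    then show ?thesis unfolding f_def by real_asymp
  qed
  from telescope_sums'[OF this] have "(\<lambda>a. f a - f (Suc a)) sums f 0" by simp
  moreover have "f 0 = cylinder_length n d" by (simp add: f_def cylinder_length_def defs)
  ultimately show ?thesis by (simp add: eq)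
qed

lemma cf_cylinder_split:
  "cf_cylinder n d \<subseteq> (\<Union>a. cf_cylinder (Suc n) (d(Suc n := 1 + int a)))"
proof
  fix x assume x: "x \<in> cf_cylinder n d"
  then have "cf_idigit x (Suc n) \<ge> 1" by (intro cf_idigit_ge_1) (auto simp: cf_cylinder_def)
  then obtain a where "cf_idigit x (Suc n) = 1 + int a" by (metis zle_iff_zadd)
  with x have "x \<in> cf_cylinder (Suc n) (d(Suc n := 1 + int a))"
    by (auto simp: cf_cylinder_def le_Suc_eq)
  then show "x \<in> (\<Union>a. cf_cylinder (Suc n) (d(Suc n := 1 + int a)))" by blast
qed


section \<open>Covering estimates and the upper bound\<close>

lemma hausdorff_premeasure_cylinder_base:
  assumes s: "s > 1" and d: "\<And>k. 1 \<le> k \<Longrightarrow> k \<le> n \<Longrightarrow> d k \<ge> 1"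
    and \<delta>: "(2 * n + 12) * (2 / 2 ^ n) \<le> \<delta>"
  shows "hausdorff_premeasure s \<delta> ((\<lambda>x. (x, error_sum x)) ` cf_cylinder n d) \<le>
    ennreal (2 * (2 * n + 12) powr s * (2 / 2 ^ n) powr (s - 1) * cylinder_length n d)"
proof -
  define G where "G = (\<lambda>x. (x, error_sum x)) ` cf_cylinder n d"
  define q q' where defs: "q = real_of_int (contden d (Suc n))" "q' = real_of_int (contden d n)"
  define c where "c = (2 * real n + 12)"
  have q: "q \<ge> 1" "0 \<le> q'" "q' \<le> q"
    using contden_nonneg_pos[of n d] contden_Suc_ge[of n d] d by (auto simp: defs simp del: contden.simps)
  \<comment> \<open>Growth from the zeroth denominator, which is 1, bounds the current one from
    below.\<close>
  have "real_of_int (2 ^ n * (contden d (Suc 0))\<^sup>2) \<le> real_of_int (2 * (contden d (Suc (0 + n)))\<^sup>2)"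
    using contden_growth[of 0 n d] d by (simp only: of_int_le_iff)
  then have "2 ^ n \<le> 2 * q\<^sup>2" by (simp add: defs)
  then have q2: "1 / q\<^sup>2 \<le> 2 / 2 ^ n" using q by (simp add: field_simps)
  have dist: "dist u v \<le> c / q\<^sup>2" if "u \<in> G" "v \<in> G" for u v
    using that cf_cylinder_dist[of _ n d] by (auto simp: G_def defs c_def)
  have bd: "bounded G"
    unfolding bounded_two_points using dist by blast
  have diam: "diameter G \<le> c / q\<^sup>2"
    by (rule diameter_le) (use dist in \<open>auto simp: dist_norm c_def\<close>)
  have "c / q\<^sup>2 \<le> \<delta>"
    using mult_left_mono[OF q2, of c] \<delta> by (simp add: c_def)
  moreover have "0 \<le> c / q\<^sup>2" by (simp add: c_def)
  ultimately have "hausdorff_premeasure s \<delta> G \<le> ennreal (diameter G powr s)"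
    using bd diam s by (intro hausdorff_premeasure_le_powr) auto
  also have "diameter G powr s \<le> (c / q\<^sup>2) powr s"
    using diam diameter_ge_0[OF bd] s by (intro powr_mono2) auto
  \<comment> \<open>One full factor \<open>1 / q\<^sup>2\<close> is kept for the additive cylinder
    length; the remaining power \<open>s - 1\<close> supplies the exponential decay.\<close>
  also have "(c / q\<^sup>2) powr s = c powr s * ((1 / q\<^sup>2) powr (s - 1) * (1 / q\<^sup>2))"
    using q powr_mult[of c "1 / q\<^sup>2" s] powr_add[of "1 / q\<^sup>2" "s - 1" 1] by (simp add: c_def)
  also have "\<dots> \<le> c powr s * ((2 / 2 ^ n) powr (s - 1) * (2 * cylinder_length n d))"
  proof (intro mult_left_mono mult_mono powr_mono2)
    have "q * (q + q') \<le> 2 * q\<^sup>2" using q by (simp add: power2_eq_square algebra_simps)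
    then show "1 / q\<^sup>2 \<le> 2 * cylinder_length n d"
      using q by (simp add: cylinder_length_def defs[symmetric] divide_simps)
  qed (use s q q2 in auto)
  finally show ?thesis by (simp add: G_def c_def mult_ac ennreal_leI)
qed

lemma cylinder_length_nonneg:
  assumes "\<And>k. 1 \<le> k \<Longrightarrow> k \<le> n \<Longrightarrow> d k \<ge> 1"
  shows "cylinder_length n d \<ge> 0"
  using contden_nonneg_pos[of n d] assms by (auto simp: cylinder_length_def simp del: contden.simps)

text \<open>Downward induction from depth \<open>N\<close>: the constant depends on \<open>N\<close>
  only, so it survives each merging of children, whose lengths sum to that of the parent.\<close>

lemma hausdorff_premeasure_cylinder_le:
  assumes s: "s > 1" and \<delta>: "(2 * N + 12) * (2 / 2 ^ N) \<le> \<delta>" and "n \<le> N"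
    and d: "\<And>k. 1 \<le> k \<Longrightarrow> k \<le> n \<Longrightarrow> d k \<ge> 1"
  shows "hausdorff_premeasure s \<delta> ((\<lambda>x. (x, error_sum x)) ` cf_cylinder n d) \<le>
    ennreal (2 * (2 * N + 12) powr s * (2 / 2 ^ N) powr (s - 1) * cylinder_length n d)"
  using \<open>n \<le> N\<close> d
proof (induction n arbitrary: d rule: inc_induct)
  case base
  then show ?case by (intro hausdorff_premeasure_cylinder_base s \<delta>)
next
  case (step n)
  define G where "G X = (\<lambda>x. (x, error_sum x)) ` X" for X
  define K where "K = 2 * (2 * N + 12) powr s * (2 / 2 ^ N) powr (s - 1)"
  define d' where "d' a = d(Suc n := 1 + int a)" for a
  have d': "\<And>k. 1 \<le> k \<Longrightarrow> k \<le> Suc n \<Longrightarrow> d' a k \<ge> 1" for a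
    using step.prems by (auto simp: d'_def)
  have "G (cf_cylinder n d) \<subseteq> (\<Union>a. G (cf_cylinder (Suc n) (d' a)))"
    using image_mono[OF cf_cylinder_split, of "\<lambda>x. (x, error_sum x)" n d]
    by (simp add: G_def d'_def image_UN)
  then have "hausdorff_premeasure s \<delta> (G (cf_cylinder n d)) \<le>
      (\<Sum>a. hausdorff_premeasure s \<delta> (G (cf_cylinder (Suc n) (d' a))))"
    by (rule order_trans[OF hausdorff_premeasure_mono hausdorff_premeasure_countable_subadditive])
  also have "\<dots> \<le> (\<Sum>a. ennreal (K * cylinder_length (Suc n) (d' a)))"
    using step.IH[OF d'] by (intro suminf_le) (auto simp: G_def K_def)
  also have "\<dots> = ennreal (K * cylinder_length n d)"
  proof (intro suminf_ennreal_eq sums_mult)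
    show "0 \<le> K * cylinder_length (Suc n) (d' a)" for a
      using cylinder_length_nonneg[of "Suc n" "d' a", OF d'] by (simp add: K_def)
    show "(\<lambda>a. cylinder_length (Suc n) (d' a)) sums cylinder_length n d"
      unfolding d'_def by (rule cylinder_length_split) (rule step.prems)
  qed
  finally show ?case by (simp add: G_def K_def)
qed

lemma hausdorff_premeasure_cylinder_0:
  assumes s: "s > 1" and \<delta>: "\<delta> > 0"
  shows "hausdorff_premeasure s \<delta> ((\<lambda>x. (x, error_sum x)) ` cf_cylinder 0 d) = 0"
proof -
  let ?m = "hausdorff_premeasure s \<delta> ((\<lambda>x. (x, error_sum x)) ` cf_cylinder 0 d)"
  define K where "K N = 2 * (2 * real N + 12) powr s * (2 / 2 ^ N) powr (s - 1)" for N :: nat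
  have "(\<lambda>N::nat. (2 * real N + 12) * (2 / 2 ^ N)) \<longlonglongrightarrow> 0" by real_asymp
  then have "\<forall>\<^sub>F N in sequentially. (2 * real N + 12) * (2 / 2 ^ N) < \<delta>"
    using \<delta> by (rule order_tendstoD)
  then have "\<forall>\<^sub>F N in sequentially. ?m \<le> ennreal (K N)"
  proof eventually_elim
    case (elim N)
    then show ?case
      \<comment> \<open>At depth 0 the digit hypothesis is vacuous and the cylinder length is 1,
        leaving just \<open>K N\<close>.\<close>
      using hausdorff_premeasure_cylinder_le[OF s, of N \<delta> 0 d] by (simp add: K_def cylinder_length_def)
  qed
  \<comment> \<open>As \<open>s - 1 > 0\<close>, the exponential decay beats the polynomial
    factor.\<close>
  moreover have "K \<longlonglongrightarrow> 0" unfolding K_def using s by real_asymp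
  then have "(\<lambda>N. ennreal (K N)) \<longlonglongrightarrow> ennreal 0" by (intro tendsto_ennrealI)
  ultimately have "?m \<le> ennreal 0" by (intro tendsto_lowerbound) auto
  then show ?thesis by simp
qed

lemma hausdorff_measure_graph_0:
  assumes s: "s > 1"
  shows "hausdorff_measure s {(x, error_sum x) | x :: real. True} = 0"
proof -
  define g where "g x = (x, error_sum x)" for x
  have "hausdorff_premeasure s \<delta> {(x, error_sum x) | x :: real. True} = 0" if \<delta>: "\<delta> > 0" for \<delta>
  proof -
    \<comment> \<open>The left summand indexes rational points as singletons, the right one the
      depth-0 cylinders by integer part; only the value of the constant function at 0
      counts.\<close>
    define A where "A = case_sum (\<lambda>r. {g r}) (\<lambda>m. g ` cf_cylinder 0 (\<lambda>_. m))"
    have "hausdorff_premeasure s \<delta> (\<Union>i \<in> \<rat> <+> UNIV. A i) = 0"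
    proof (rule hausdorff_premeasure_UN_eq_0)
      show "countable (\<rat> <+> (UNIV :: int set))" by (auto intro: countable_Plus countable_rat)
      fix i :: "real + int" assume "i \<in> \<rat> <+> UNIV"
      then show "hausdorff_premeasure s \<delta> (A i) = 0"
        using hausdorff_premeasure_le_powr[of "{g _}" \<delta> s] s \<delta>
          hausdorff_premeasure_cylinder_0[OF s \<delta>]
        by (auto simp: A_def g_def[abs_def])
    qed (use s \<delta> in auto)
    moreover have "{(x, error_sum x) | x. True} \<subseteq> (\<Union>i \<in> \<rat> <+> UNIV. A i)"
    proof clarify
      fix x
      show "(x, error_sum x) \<in> (\<Union>i \<in> \<rat> <+> UNIV. A i)"
      proof (cases "x \<in> \<rat>")
        case True
        then show ?thesis by (intro UN_I[of "Inl x"]) (auto simp: A_def g_def)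
      next
        case False
        then have "x \<in> cf_cylinder 0 (\<lambda>_. \<lfloor>x\<rfloor>)" by (simp add: cf_cylinder_def cf_idigit_def)
        then show ?thesis by (intro UN_I[of "Inr \<lfloor>x\<rfloor>"]) (auto simp: A_def g_def)
      qed
    qed
    then have "hausdorff_premeasure s \<delta> {(x, error_sum x) | x. True} \<le>
        hausdorff_premeasure s \<delta> (\<Union>i \<in> \<rat> <+> UNIV. A i)"
      by (rule hausdorff_premeasure_mono)
    ultimately show ?thesis by simp
  qed
  then show ?thesis unfolding hausdorff_measure_def by (simp add: SUP_eq_const)
qed

section \<open>The dimension of the graph\<close>

theorem theorem1p1:
  shows "hausdorff_dim {(x, error_sum x) | x :: real. True} = 1"
proof (rule antisym)
  let ?G = "{(x, error_sum x) | x :: real. True}"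
  show "hausdorff_dim ?G \<le> 1"
  proof (rule ennreal_le_epsilon)
    fix e :: real assume e: "0 < e"
    then have "hausdorff_dim ?G \<le> ennreal (1 + e)"
      unfolding hausdorff_dim_def using hausdorff_measure_graph_0[of "1 + e"]
      by (intro INF_lower) auto
    also have "ennreal (1 + e) = 1 + ennreal e" using e by simp
    finally show "hausdorff_dim ?G \<le> 1 + ennreal e" .
  qed
  show "1 \<le> hausdorff_dim ?G"
    unfolding hausdorff_dim_def
  proof (rule INF_greatest)
    fix s :: real assume s: "s \<in> {s. s \<ge> 0 \<and> hausdorff_measure s ?G = 0}"
    have "1 \<le> s"
    proof (rule ccontr)
      assume "\<not> 1 \<le> s"
      \<comment> \<open>The single scale 1 suffices, since the measure is the supremum over all
        scales.\<close>
      with s have "1 \<le> hausdorff_premeasure s 1 ?G"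
        by (intro hausdorff_premeasure_graph_ge_1) auto
      also have "\<dots> \<le> hausdorff_measure s ?G"
        unfolding hausdorff_measure_def by (intro SUP_upper) auto
      finally show False using s by simp
    qed
    then show "1 \<le> ennreal s" by (metis ennreal_1 ennreal_leI)
  qed
qed

end
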